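(* Let $(L,[\cdot,\cdot],\alpha)$ be a Hom-Lie algebra over a field $k$, let $u$ be an $\alpha$-invariant element of $Z(L)$ (i.e. $u\in Z(L)$ and $\alpha(u)=u$), and let $\lambda,\nu\in k$. Then the linear map $$B: L\otimes L\to L\otimes L,\qquad x\otimes y\mapsto \lambda\,[x,y]\otimes u-\nu\,\alpha(y)\otimes\alpha(x)$$ is a solution of the Hom-Yang-Baxter equation (with respect to the twist map $\alpha$ on $L$), where $Z(L)=\{u\in L\mid [u,x]=0\ \ \forall x\in L\}$.
   Context: Throughout, $k$ is a fixed field; vector spaces, linear maps and tensor products are over $k$. A Hom-Lie algebra is a triple $(L,[\cdot,\cdot],\alpha)$ consisting of a $k$-linear space $L$, a bilinear map $[\cdot,\cdot]:L\otimes L\to L$ and an endomorphism $\alpha:L\to L$ (linear, with $\alpha([l,l'])=[\alpha(l),\alpha(l')]$), such that for all $l,l',l''\in L$: $[l,l']=-[l',l]$ and $[\alpha(l),[l',l'']]+[\alpha(l'),[l'',l]]+[\alpha(l''),[l,l']]=0$. Hom-Yang-Baxter equation (HYBE): given a vector space $V$ and a linear endomorphism $\alpha$ of $V$, a linear map $B:V\otimes V\to V\otimes V$ is a solution of the HYBE if $B$ commutes with $\alpha\otimes\alpha$, i.e. $(\alpha\otimes\alpha)\circ B=B\circ(\alpha\otimes\alpha)$, and $$(\alpha\otimes B)\circ(B\otimes\alpha)\circ(\alpha\otimes B)=(B\otimes\alpha)\circ(\alpha\otimes B)\circ(B\otimes\alpha)$$ as maps $V\otimes V\otimes V\to V\otimes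 V\otimes V$. *)

theory Defs
  imports "HOL-Algebra.Module" "HOL-Algebra.AbelCoset" "HOL-Library.FuncSet"
begin

section \<open>Linear and bilinear maps\<close>

definition linear_maps ::
    "('a, 'r) ring_scheme \<Rightarrow> ('a, 'b, 'm) module_scheme \<Rightarrow> ('a, 'c, 'n) module_scheme \<Rightarrow> ('b \<Rightarrow> 'c) set"
  where "linear_maps R V W =
    {f \<in> carrier V \<rightarrow> carrier W.
      (\<forall>x\<in>carrier V. \<forall>y\<in>carrier V. f (x \<oplus>\<^bsub>V\<^esub> y) = f x \<oplus>\<^bsub>W\<^esub> f y) \<and>
      (\<forall>a\<in>carrier R. \<forall>x\<in>carrier V. f (a \<odot>\<^bsub>V\<^esub> x) = a \<odot>\<^bsub>W\<^esub> f x)}"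

definition bilinear_maps ::
    "('a, 'r) ring_scheme \<Rightarrow> ('a, 'b, 'm) module_scheme \<Rightarrow> ('a, 'c, 'n) module_scheme
      \<Rightarrow> ('a, 'd, 'p) module_scheme \<Rightarrow> ('b \<Rightarrow> 'c \<Rightarrow> 'd) set"
  where "bilinear_maps R V W M =
    {h. (\<forall>x\<in>carrier V. h x \<in> linear_maps R W M) \<and>
        (\<forall>y\<in>carrier W. (\<lambda>x. h x y) \<in> linear_maps R V M)}"

section \<open>Tensor products\<close>

text \<open>The free module on \<open>X\<close>: finitely supported functions, taken to be zero outside \<open>X\<close>.
  The fields \<open>mult\<close> and \<open>one\<close> that the record \<open>module\<close> inherits from \<open>ring\<close> play no role in a
  module and are left undefined here and below.\<close>

definition free_module :: "('a, 'r) ring_scheme \<Rightarrow> 'x set \<Rightarrow> ('a, 'x \<Rightarrow> 'a) module"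
  where "free_module R X =
    \<lparr>carrier = {f. (\<forall>x. f x \<in> carrier R) \<and> (\<forall>x. x \<notin> X \<longrightarrow> f x = \<zero>\<^bsub>R\<^esub>) \<and> finite {x. f x \<noteq> \<zero>\<^bsub>R\<^esub>}},
     mult = undefined, one = undefined,
     zero = (\<lambda>x. \<zero>\<^bsub>R\<^esub>), add = (\<lambda>f g x. f x \<oplus>\<^bsub>R\<^esub> g x),
     smult = (\<lambda>a f x. a \<otimes>\<^bsub>R\<^esub> f x)\<rparr>"

definition free_gen :: "('a, 'r) ring_scheme \<Rightarrow> 'x \<Rightarrow> 'x \<Rightarrow> 'a"
  where "free_gen R x = (\<lambda>y. if y = x then \<one>\<^bsub>R\<^esub> else \<zero>\<^bsub>R\<^esub>)"

definition submodule_generated ::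
    "('a, 'r) ring_scheme \<Rightarrow> ('a, 'b, 'm) module_scheme \<Rightarrow> 'b set \<Rightarrow> 'b set"
  where "submodule_generated R M S = \<Inter>{N. submodule N R M \<and> S \<subseteq> N}"

definition quotient_module :: "('a, 'b, 'm) module_scheme \<Rightarrow> 'b set \<Rightarrow> ('a, 'b set) module"
  where "quotient_module M N =
    \<lparr>carrier = a_rcosets\<^bsub>M\<^esub> N,
     mult = undefined, one = undefined,
     zero = N, add = set_add M,
     smult = (\<lambda>a A. \<Union>x\<in>A. N +>\<^bsub>M\<^esub> (a \<odot>\<^bsub>M\<^esub> x))\<rparr>"

definition tensor_relations ::
    "('a, 'r) ring_scheme \<Rightarrow> ('a, 'b, 'm) module_scheme \<Rightarrow> ('a, 'c, 'n) module_scheme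
      \<Rightarrow> ('b \<times> 'c \<Rightarrow> 'a) set"
  where "tensor_relations R V W =
    (let F = free_module R (carrier V \<times> carrier W); \<delta> = (\<lambda>x y. free_gen R (x, y)) in
      {\<delta> (x \<oplus>\<^bsub>V\<^esub> x') y \<ominus>\<^bsub>F\<^esub> (\<delta> x y \<oplus>\<^bsub>F\<^esub> \<delta> x' y) | x x' y.
         x \<in> carrier V \<and> x' \<in> carrier V \<and> y \<in> carrier W} \<union>
      {\<delta> x (y \<oplus>\<^bsub>W\<^esub> y') \<ominus>\<^bsub>F\<^esub> (\<delta> x y \<oplus>\<^bsub>F\<^esub> \<delta> x y') | x y y'.
         x \<in> carrier V \<and> y \<in> carrier W \<and> y' \<in> carrier W} \<union>
      {\<delta> (a \<odot>\<^bsub>V\<^esub> x) y \<ominus>\<^bsub>F\<^esub> (a \<odot>\<^bsub>F\<^esub> \<delta> x y) | a x y.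
         a \<in> carrier R \<and> x \<in> carrier V \<and> y \<in> carrier W} \<union>
      {\<delta> x (a \<odot>\<^bsub>W\<^esub> y) \<ominus>\<^bsub>F\<^esub> (a \<odot>\<^bsub>F\<^esub> \<delta> x y) | a x y.
         a \<in> carrier R \<and> x \<in> carrier V \<and> y \<in> carrier W})"

definition tensor_kernel ::
    "('a, 'r) ring_scheme \<Rightarrow> ('a, 'b, 'm) module_scheme \<Rightarrow> ('a, 'c, 'n) module_scheme
      \<Rightarrow> ('b \<times> 'c \<Rightarrow> 'a) set"
  where "tensor_kernel R V W =
    submodule_generated R (free_module R (carrier V \<times> carrier W)) (tensor_relations R V W)"

definition tensor ::
    "('a, 'r) ring_scheme \<Rightarrow> ('a, 'b, 'm) module_scheme \<Rightarrow> ('a, 'c, 'n) module_scheme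
      \<Rightarrow> ('a, ('b \<times> 'c \<Rightarrow> 'a) set) module"
  where "tensor R V W =
    quotient_module (free_module R (carrier V \<times> carrier W)) (tensor_kernel R V W)"

definition pure_tensor ::
    "('a, 'r) ring_scheme \<Rightarrow> ('a, 'b, 'm) module_scheme \<Rightarrow> ('a, 'c, 'n) module_scheme
      \<Rightarrow> 'b \<Rightarrow> 'c \<Rightarrow> ('b \<times> 'c \<Rightarrow> 'a) set"
  where "pure_tensor R V W x y =
    tensor_kernel R V W +>\<^bsub>free_module R (carrier V \<times> carrier W)\<^esub> free_gen R (x, y)"

text \<open>The linear map on \<open>V \<otimes> W\<close> induced by a bilinear map \<open>h\<close>. Functions are total in HOL, so
  uniqueness requires fixing the values outside the carrier, which \<open>extensional\<close> does.\<close>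

definition tensor_lift ::
    "('a, 'r) ring_scheme \<Rightarrow> ('a, 'b, 'm) module_scheme \<Rightarrow> ('a, 'c, 'n) module_scheme
      \<Rightarrow> ('a, 'd, 'p) module_scheme \<Rightarrow> ('b \<Rightarrow> 'c \<Rightarrow> 'd) \<Rightarrow> ('b \<times> 'c \<Rightarrow> 'a) set \<Rightarrow> 'd"
  where "tensor_lift R V W M h =
    (THE f. f \<in> linear_maps R (tensor R V W) M \<inter> extensional (carrier (tensor R V W)) \<and>
      (\<forall>x\<in>carrier V. \<forall>y\<in>carrier W. f (pure_tensor R V W x y) = h x y))"

text \<open>\<open>f \<otimes> g : V \<otimes> W \<rightarrow> V' \<otimes> W'\<close> for \<open>f : V \<rightarrow> V'\<close> and \<open>g : W \<rightarrow> W'\<close>.\<close>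

definition tensor_map ::
    "('a, 'r) ring_scheme \<Rightarrow> ('a, 'b, 'm) module_scheme \<Rightarrow> ('a, 'c, 'n) module_scheme
      \<Rightarrow> ('a, 'd, 'p) module_scheme \<Rightarrow> ('a, 'e, 'q) module_scheme
      \<Rightarrow> ('b \<Rightarrow> 'd) \<Rightarrow> ('c \<Rightarrow> 'e) \<Rightarrow> ('b \<times> 'c \<Rightarrow> 'a) set \<Rightarrow> ('d \<times> 'e \<Rightarrow> 'a) set"
  where "tensor_map R V W V' W' f g =
    tensor_lift R V W (tensor R V' W') (\<lambda>x y. pure_tensor R V' W' (f x) (g y))"

text \<open>The associator \<open>(U \<otimes> V) \<otimes> W \<rightarrow> U \<otimes> (V \<otimes> W)\<close>, \<open>(x \<otimes> y) \<otimes> z \<mapsto> x \<otimes> (y \<otimes> z)\<close>.\<close>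

definition tensor_assoc ::
    "('a, 'r) ring_scheme \<Rightarrow> ('a, 'b, 'm) module_scheme \<Rightarrow> ('a, 'c, 'n) module_scheme
      \<Rightarrow> ('a, 'd, 'p) module_scheme
      \<Rightarrow> (('b \<times> 'c \<Rightarrow> 'a) set \<times> 'd \<Rightarrow> 'a) set \<Rightarrow> ('b \<times> ('c \<times> 'd \<Rightarrow> 'a) set \<Rightarrow> 'a) set"
  where "tensor_assoc R U V W =
    tensor_lift R (tensor R U V) W (tensor R U (tensor R V W))
      (\<lambda>t z. tensor_lift R U V (tensor R U (tensor R V W))
        (\<lambda>x y. pure_tensor R U (tensor R V W) x (pure_tensor R V W y z)) t)"

section \<open>The Hom-Yang-Baxter equation\<close>

text \<open>\<open>V \<otimes> V \<otimes> V\<close> is read as \<open>V \<otimes> (V \<otimes> V)\<close>; the map \<open>B \<otimes> \<alpha>\<close>, which lives on \<open>(V \<otimes> V) \<otimes> V\<close>, is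
  transported there along the associator.\<close>

definition twist_right ::
    "('a, 'r) ring_scheme \<Rightarrow> ('a, 'b, 'm) module_scheme \<Rightarrow> ('b \<Rightarrow> 'b)
      \<Rightarrow> (('b \<times> 'b \<Rightarrow> 'a) set \<Rightarrow> ('b \<times> 'b \<Rightarrow> 'a) set)
      \<Rightarrow> ('b \<times> ('b \<times> 'b \<Rightarrow> 'a) set \<Rightarrow> 'a) set \<Rightarrow> ('b \<times> ('b \<times> 'b \<Rightarrow> 'a) set \<Rightarrow> 'a) set"
  where "twist_right R V \<alpha> B =
    tensor_assoc R V V V
      \<circ> tensor_map R (tensor R V V) V (tensor R V V) V B \<alpha>
      \<circ> inv_into (carrier (tensor R (tensor R V V) V)) (tensor_assoc R V V V)"

definition twist_left ::
    "('a, 'r) ring_scheme \<Rightarrow> ('a, 'b, 'm) module_scheme \<Rightarrow> ('b \<Rightarrow> 'b)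
      \<Rightarrow> (('b \<times> 'b \<Rightarrow> 'a) set \<Rightarrow> ('b \<times> 'b \<Rightarrow> 'a) set)
      \<Rightarrow> ('b \<times> ('b \<times> 'b \<Rightarrow> 'a) set \<Rightarrow> 'a) set \<Rightarrow> ('b \<times> ('b \<times> 'b \<Rightarrow> 'a) set \<Rightarrow> 'a) set"
  where "twist_left R V \<alpha> B = tensor_map R V (tensor R V V) V (tensor R V V) \<alpha> B"

definition hom_yang_baxter_solution ::
    "('a, 'r) ring_scheme \<Rightarrow> ('a, 'b, 'm) module_scheme \<Rightarrow> ('b \<Rightarrow> 'b)
      \<Rightarrow> (('b \<times> 'b \<Rightarrow> 'a) set \<Rightarrow> ('b \<times> 'b \<Rightarrow> 'a) set) \<Rightarrow> bool"
  where "hom_yang_baxter_solution R V \<alpha> B \<longleftrightarrow>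
    \<alpha> \<in> linear_maps R V V \<and>
    B \<in> linear_maps R (tensor R V V) (tensor R V V) \<and>
    (\<forall>t\<in>carrier (tensor R V V).
      (tensor_map R V V V V \<alpha> \<alpha> \<circ> B) t = (B \<circ> tensor_map R V V V V \<alpha> \<alpha>) t) \<and>
    (\<forall>t\<in>carrier (tensor R V (tensor R V V)).
      (twist_left R V \<alpha> B \<circ> twist_right R V \<alpha> B \<circ> twist_left R V \<alpha> B) t =
      (twist_right R V \<alpha> B \<circ> twist_left R V \<alpha> B \<circ> twist_right R V \<alpha> B) t)"

section \<open>Hom-Lie algebras\<close>

locale hom_lie_algebra = R?: field R + L?: module R L
  for R (structure) and L (structure) +
  fixes br :: "'c \<Rightarrow> 'c \<Rightarrow> 'c" and \<alpha> :: "'c \<Rightarrow> 'c"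
  assumes br_bilinear: "br \<in> bilinear_maps R L L L"
    and \<alpha>_linear: "\<alpha> \<in> linear_maps R L L"
    and \<alpha>_br: "\<lbrakk>x \<in> carrier L; y \<in> carrier L\<rbrakk> \<Longrightarrow> \<alpha> (br x y) = br (\<alpha> x) (\<alpha> y)"
    and br_skew: "\<lbrakk>x \<in> carrier L; y \<in> carrier L\<rbrakk> \<Longrightarrow> br x y = \<ominus>\<^bsub>L\<^esub> br y x"
    and hom_jacobi: "\<lbrakk>x \<in> carrier L; y \<in> carrier L; z \<in> carrier L\<rbrakk> \<Longrightarrow>
      br (\<alpha> x) (br y z) \<oplus>\<^bsub>L\<^esub> br (\<alpha> y) (br z x) \<oplus>\<^bsub>L\<^esub> br (\<alpha> z) (br x y) = \<zero>\<^bsub>L\<^esub>"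

definition hom_lie_center :: "('a, 'b, 'm) module_scheme \<Rightarrow> ('b \<Rightarrow> 'b \<Rightarrow> 'b) \<Rightarrow> 'b set"
  where "hom_lie_center L br = {u \<in> carrier L. \<forall>x\<in>carrier L. br u x = \<zero>\<^bsub>L\<^esub>}"

end

theory Submission
  imports Defs
begin

text \<open>
  The map \<open>B\<close> is well defined because its formula is bilinear in \<open>x\<close> and \<open>y\<close>: existence and
  uniqueness are the universal property of the tensor product (\<open>tensor_lift_ex1\<close>), which is
  derived from the construction as a quotient of a free module.

  Both sides of the Hom-Yang-Baxter equation are linear, so it is enough to compare them on the
  pure triples \<open>x \<otimes> y \<otimes> z\<close>, which span \<open>L \<otimes> L \<otimes> L\<close>. For this the associator must be inverted on
  pure tensors (\<open>tensor_assoc_inverse\<close>), since \<open>B \<otimes> \<alpha>\<close> is transported along it. Write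
  \<open>\<lambda>\<close> for the scalar \<open>l\<close> and \<open>n = -\<nu>\<close>. As \<open>u\<close> is central, \<open>[u, -]\<close> and \<open>[-, u]\<close> vanish, and with \<open>\<alpha> u = u\<close> the left-hand
  side becomes

  \<open>\<lambda>\<^sup>2n \<alpha>[\<alpha>x, [y, z]] \<otimes> u \<otimes> u + n\<^sup>3 \<alpha>\<^sup>3z \<otimes> \<alpha>\<^sup>3y \<otimes> \<alpha>\<^sup>3x\<close>
  \<open>+ \<lambda>n\<^sup>2 (\<alpha>\<^sup>2[y, z] \<otimes> u \<otimes> \<alpha>\<^sup>3x + \<alpha>\<^sup>2[x, z] \<otimes> \<alpha>\<^sup>3y \<otimes> u + \<alpha>\<^sup>3z \<otimes> \<alpha>\<^sup>2[x, y] \<otimes> u)\<close>.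

  The right-hand side has the same terms, except that the first one is
  \<open>\<lambda>\<^sup>2n ([\<alpha>[x, y], \<alpha>\<^sup>2z] + [\<alpha>\<^sup>2y, [\<alpha>x, \<alpha>z]]) \<otimes> u \<otimes> u\<close>. The two agree by the Hom-Jacobi identity for
  \<open>\<alpha>x\<close>, \<open>\<alpha>y\<close>, \<open>\<alpha>z\<close>, read as a derivation rule (\<open>jacobi_derivation\<close>).

  That \<open>B\<close> commutes with \<open>\<alpha> \<otimes> \<alpha>\<close> follows in the same way from \<open>\<alpha>[x, y] = [\<alpha>x, \<alpha>y]\<close> and \<open>\<alpha> u = u\<close>.
\<close>

section \<open>Linear and bilinear maps\<close>

lemma (in abelian_group) minus_eq_zero_iff:
  "\<lbrakk>x \<in> carrier G; y \<in> carrier G\<rbrakk> \<Longrightarrow> x \<ominus> y = \<zero> \<longleftrightarrow> x = y"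
  by (metis a_minus_def add.inv_solve_right add.one_closed l_zero)

lemma linear_mapsI:
  assumes "\<And>x. x \<in> carrier V \<Longrightarrow> f x \<in> carrier W"
    and "\<And>x y. \<lbrakk>x \<in> carrier V; y \<in> carrier V\<rbrakk> \<Longrightarrow> f (x \<oplus>\<^bsub>V\<^esub> y) = f x \<oplus>\<^bsub>W\<^esub> f y"
    and "\<And>a x. \<lbrakk>a \<in> carrier R; x \<in> carrier V\<rbrakk> \<Longrightarrow> f (a \<odot>\<^bsub>V\<^esub> x) = a \<odot>\<^bsub>W\<^esub> f x"
  shows "f \<in> linear_maps R V W"
  using assms by (auto simp: linear_maps_def)

lemma
  assumes "f \<in> linear_maps R V W"
  shows linear_maps_closed: "x \<in> carrier V \<Longrightarrow> f x \<in> carrier W"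
    and linear_maps_add:
      "\<lbrakk>x \<in> carrier V; y \<in> carrier V\<rbrakk> \<Longrightarrow> f (x \<oplus>\<^bsub>V\<^esub> y) = f x \<oplus>\<^bsub>W\<^esub> f y"
    and linear_maps_smult:
      "\<lbrakk>a \<in> carrier R; x \<in> carrier V\<rbrakk> \<Longrightarrow> f (a \<odot>\<^bsub>V\<^esub> x) = a \<odot>\<^bsub>W\<^esub> f x"
  using assms by (auto simp: linear_maps_def)

lemma linear_maps_zero:
  assumes "module R V" "module R W" "f \<in> linear_maps R V W"
  shows "f \<zero>\<^bsub>V\<^esub> = \<zero>\<^bsub>W\<^esub>"
proof -
  interpret V: module R V by fact
  interpret W: module R W by fact
  have "f (\<zero>\<^bsub>R\<^esub> \<odot>\<^bsub>V\<^esub> \<zero>\<^bsub>V\<^esub>) = \<zero>\<^bsub>R\<^esub> \<odot>\<^bsub>W\<^esub> f \<zero>\<^bsub>V\<^esub>"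
    by (rule linear_maps_smult[OF assms(3)]) simp_all
  then show ?thesis
    using linear_maps_closed[OF assms(3)] by simp
qed

lemma linear_maps_minus:
  assumes "module R V" "module R W" "f \<in> linear_maps R V W" "x \<in> carrier V" "y \<in> carrier V"
  shows "f (x \<ominus>\<^bsub>V\<^esub> y) = f x \<ominus>\<^bsub>W\<^esub> f y"
proof -
  interpret V: module R V by fact
  interpret W: module R W by fact
  note f = assms(3)
  have "f (\<ominus>\<^bsub>V\<^esub> y) = f ((\<ominus>\<^bsub>R\<^esub> \<one>\<^bsub>R\<^esub>) \<odot>\<^bsub>V\<^esub> y)"
    using assms(5) by (simp add: V.smult_l_minus)
  also have "\<dots> = \<ominus>\<^bsub>W\<^esub> f y"
    using assms(5) linear_maps_closed[OF f] by (simp add: linear_maps_smult[OF f] W.smult_l_minus)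
  finally show ?thesis
    using assms(4,5) by (simp add: a_minus_def linear_maps_add[OF f])
qed

lemma linear_maps_comp:
  assumes "f \<in> linear_maps R U V" "g \<in> linear_maps R V W"
  shows "g \<circ> f \<in> linear_maps R U W"
  using assms
  by (intro linear_mapsI) (simp_all add: linear_maps_closed linear_maps_add linear_maps_smult)

lemma linear_maps_id: "(\<lambda>x. x) \<in> linear_maps R V V"
  by (auto simp: linear_maps_def)

lemma linear_maps_restrict:
  assumes "module R V" "f \<in> linear_maps R V W"
  shows "restrict f (carrier V) \<in> linear_maps R V W"
proof -
  interpret V: module R V by fact
  show ?thesis using assms(2) by (auto simp: linear_maps_def)
qed

lemma linear_maps_zero_map:
  assumes "module R V" "module R W"
  shows "(\<lambda>x. \<zero>\<^bsub>W\<^esub>) \<in> linear_maps R V W"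
proof -
  interpret W: module R W by fact
  show ?thesis by (rule linear_mapsI) simp_all
qed

lemma linear_maps_plus:
  assumes "module R V" "module R W" "f \<in> linear_maps R V W" "g \<in> linear_maps R V W"
  shows "(\<lambda>x. f x \<oplus>\<^bsub>W\<^esub> g x) \<in> linear_maps R V W"
proof -
  interpret V: module R V by fact
  interpret W: module R W by fact
  note fg = linear_maps_closed[OF assms(3)] linear_maps_add[OF assms(3)] linear_maps_smult[OF assms(3)]
    linear_maps_closed[OF assms(4)] linear_maps_add[OF assms(4)] linear_maps_smult[OF assms(4)]
  show ?thesis by (rule linear_mapsI) (simp_all add: fg W.smult_r_distr W.a_ac)
qed

lemma linear_maps_scale:
  assumes "module R V" "module R W" "f \<in> linear_maps R V W" "a \<in> carrier R"
  shows "(\<lambda>x. a \<odot>\<^bsub>W\<^esub> f x) \<in> linear_maps R V W"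
proof -
  interpret V: module R V by fact
  interpret W: module R W by fact
  note f = linear_maps_closed[OF assms(3)] linear_maps_add[OF assms(3)] linear_maps_smult[OF assms(3)]
  show ?thesis
    using assms(4)
    by (intro linear_mapsI)
      (simp_all add: f W.smult_r_distr W.smult_assoc1[symmetric] V.m_comm)
qed

lemma bilinear_mapsI:
  assumes "\<And>x y. \<lbrakk>x \<in> carrier V; y \<in> carrier W\<rbrakk> \<Longrightarrow> h x y \<in> carrier M"
    and "\<And>x x' y. \<lbrakk>x \<in> carrier V; x' \<in> carrier V; y \<in> carrier W\<rbrakk>
      \<Longrightarrow> h (x \<oplus>\<^bsub>V\<^esub> x') y = h x y \<oplus>\<^bsub>M\<^esub> h x' y"
    and "\<And>x y y'. \<lbrakk>x \<in> carrier V; y \<in> carrier W; y' \<in> carrier W\<rbrakk>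
      \<Longrightarrow> h x (y \<oplus>\<^bsub>W\<^esub> y') = h x y \<oplus>\<^bsub>M\<^esub> h x y'"
    and "\<And>a x y. \<lbrakk>a \<in> carrier R; x \<in> carrier V; y \<in> carrier W\<rbrakk>
      \<Longrightarrow> h (a \<odot>\<^bsub>V\<^esub> x) y = a \<odot>\<^bsub>M\<^esub> h x y"
    and "\<And>a x y. \<lbrakk>a \<in> carrier R; x \<in> carrier V; y \<in> carrier W\<rbrakk>
      \<Longrightarrow> h x (a \<odot>\<^bsub>W\<^esub> y) = a \<odot>\<^bsub>M\<^esub> h x y"
  shows "h \<in> bilinear_maps R V W M"
  using assms by (auto simp: bilinear_maps_def linear_maps_def)

lemma
  assumes "h \<in> bilinear_maps R V W M"
  shows bilinear_maps_left: "y \<in> carrier W \<Longrightarrow> (\<lambda>x. h x y) \<in> linear_maps R V M"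
    and bilinear_maps_right: "x \<in> carrier V \<Longrightarrow> h x \<in> linear_maps R W M"
    and bilinear_maps_closed: "\<lbrakk>x \<in> carrier V; y \<in> carrier W\<rbrakk> \<Longrightarrow> h x y \<in> carrier M"
    and bilinear_maps_add_left: "\<lbrakk>x \<in> carrier V; x' \<in> carrier V; y \<in> carrier W\<rbrakk>
      \<Longrightarrow> h (x \<oplus>\<^bsub>V\<^esub> x') y = h x y \<oplus>\<^bsub>M\<^esub> h x' y"
    and bilinear_maps_add_right: "\<lbrakk>x \<in> carrier V; y \<in> carrier W; y' \<in> carrier W\<rbrakk>
      \<Longrightarrow> h x (y \<oplus>\<^bsub>W\<^esub> y') = h x y \<oplus>\<^bsub>M\<^esub> h x y'"
    and bilinear_maps_smult_left: "\<lbrakk>a \<in> carrier R; x \<in> carrier V; y \<in> carrier W\<rbrakk>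
      \<Longrightarrow> h (a \<odot>\<^bsub>V\<^esub> x) y = a \<odot>\<^bsub>M\<^esub> h x y"
    and bilinear_maps_smult_right: "\<lbrakk>a \<in> carrier R; x \<in> carrier V; y \<in> carrier W\<rbrakk>
      \<Longrightarrow> h x (a \<odot>\<^bsub>W\<^esub> y) = a \<odot>\<^bsub>M\<^esub> h x y"
  using assms by (auto simp: bilinear_maps_def linear_maps_def)

lemmas bilinear_maps_simps =
  bilinear_maps_closed bilinear_maps_add_left bilinear_maps_add_right
  bilinear_maps_smult_left bilinear_maps_smult_right

lemma bilinear_maps_comp:
  assumes "h \<in> bilinear_maps R V W M"
    and "f \<in> linear_maps R V' V" "g \<in> linear_maps R W' W" "k \<in> linear_maps R M N"
  shows "(\<lambda>x y. k (h (f x) (g y))) \<in> bilinear_maps R V' W' N"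
  using assms(2-4)
  by (intro bilinear_mapsI)
    (simp_all add: bilinear_maps_simps[OF assms(1)] linear_maps_closed linear_maps_add linear_maps_smult)

lemma bilinear_maps_plus:
  assumes "module R V" "module R W" "module R M"
    and "h \<in> bilinear_maps R V W M" "k \<in> bilinear_maps R V W M"
  shows "(\<lambda>x y. h x y \<oplus>\<^bsub>M\<^esub> k x y) \<in> bilinear_maps R V W M"
  using assms(4,5)
  by (simp add: bilinear_maps_def linear_maps_plus[OF assms(1,3)] linear_maps_plus[OF assms(2,3)])

lemma bilinear_maps_scale:
  assumes "module R V" "module R W" "module R M"
    and "h \<in> bilinear_maps R V W M" "a \<in> carrier R"
  shows "(\<lambda>x y. a \<odot>\<^bsub>M\<^esub> h x y) \<in> bilinear_maps R V W M"
  using assms(4,5)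
  by (simp add: bilinear_maps_def linear_maps_scale[OF assms(1,3)] linear_maps_scale[OF assms(2,3)])

lemma bilinear_maps_flip:
  "h \<in> bilinear_maps R V W M \<Longrightarrow> (\<lambda>y x. h x y) \<in> bilinear_maps R W V M"
  by (auto simp: bilinear_maps_def)

section \<open>Free modules\<close>

context cring
begin

lemma module_free_module: "module R (free_module R X)" (is "module R ?F")
proof (rule moduleI)
  show "cring R" ..
  have add: "f \<oplus>\<^bsub>?F\<^esub> g \<in> carrier ?F" if "f \<in> carrier ?F" "g \<in> carrier ?F" for f g
  proof -
    have "{x. f x \<oplus> g x \<noteq> \<zero>} \<subseteq> {x. f x \<noteq> \<zero>} \<union> {x. g x \<noteq> \<zero>}" by auto
    with that show ?thesis by (auto simp: free_module_def intro: finite_subset)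
  qed
  have smult: "a \<odot>\<^bsub>?F\<^esub> f \<in> carrier ?F" if "a \<in> carrier R" "f \<in> carrier ?F" for a f
  proof -
    have "{x. a \<otimes> f x \<noteq> \<zero>} \<subseteq> {x. f x \<noteq> \<zero>}" using that by auto
    with that show ?thesis by (auto simp: free_module_def intro: finite_subset)
  qed
  show "abelian_group ?F"
  proof (rule abelian_groupI)
    fix f assume f: "f \<in> carrier ?F"
    have "(\<ominus> \<one>) \<odot>\<^bsub>?F\<^esub> f \<oplus>\<^bsub>?F\<^esub> f = \<zero>\<^bsub>?F\<^esub>"
      using f by (simp add: free_module_def fun_eq_iff l_minus l_neg)
    with smult[OF _ f] show "\<exists>g\<in>carrier ?F. g \<oplus>\<^bsub>?F\<^esub> f = \<zero>\<^bsub>?F\<^esub>" by auto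
  qed (use add in \<open>auto simp: free_module_def a_ac\<close>)
  show "\<And>a x. a \<in> carrier R \<Longrightarrow> x \<in> carrier ?F \<Longrightarrow> a \<odot>\<^bsub>?F\<^esub> x \<in> carrier ?F"
    by (rule smult)
qed (auto simp: free_module_def l_distr r_distr m_assoc)

lemma free_gen_closed: "x \<in> X \<Longrightarrow> free_gen R x \<in> carrier (free_module R X)"
  by (auto simp: free_module_def free_gen_def)

text \<open>Splitting off one point of the support at a time shows that the multiples of generators
  span the free module.\<close>

lemma free_module_induct [consumes 1, case_names zero gen add]:
  assumes "f \<in> carrier (free_module R X)"
    and zero: "P \<zero>\<^bsub>free_module R X\<^esub>"
    and gen: "\<And>a x. a \<in> carrier R \<Longrightarrow> x \<in> X \<Longrightarrow> P (a \<odot>\<^bsub>free_module R X\<^esub> free_gen R x)"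
    and add: "\<And>f g. f \<in> carrier (free_module R X) \<Longrightarrow> g \<in> carrier (free_module R X) \<Longrightarrow>
      P f \<Longrightarrow> P g \<Longrightarrow> P (f \<oplus>\<^bsub>free_module R X\<^esub> g)"
  shows "P f"
proof -
  let ?F = "free_module R X"
  interpret F: module R ?F by (rule module_free_module)
  have "P f" if "finite A" "f \<in> carrier ?F" "{x. f x \<noteq> \<zero>} = A" for A f
    using that
  proof (induction A arbitrary: f rule: finite_induct)
    case empty
    then have "f = \<zero>\<^bsub>?F\<^esub>" by (auto simp: free_module_def)
    with zero show ?case by simp
  next
    case (insert x A)
    define g where "g = f(x := \<zero>)"
    have x: "x \<in> X" "f x \<in> carrier R"
      using insert.prems by (auto simp: free_module_def)
    have supp: "{y. g y \<noteq> \<zero>} = A"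
      using insert.prems(2) insert.hyps(2) by (auto simp: g_def)
    have g: "g \<in> carrier ?F"
      using insert.prems insert.hyps supp by (auto simp: free_module_def g_def)
    have "f = g \<oplus>\<^bsub>?F\<^esub> f x \<odot>\<^bsub>?F\<^esub> free_gen R x"
      using insert.prems by (auto simp: free_module_def g_def free_gen_def fun_eq_iff)
    with add[OF g _ insert.IH[OF g supp] gen[OF x(2,1)]] x show ?case
      by (simp add: free_gen_closed)
  qed
  moreover have "finite {x. f x \<noteq> \<zero>}" using assms(1) by (simp add: free_module_def)
  ultimately show ?thesis using assms(1) by blast
qed

end

text \<open>The linear extension of \<open>h\<close> to the free module on its domain; summing over the support keeps
  the index set finite.\<close>

definition free_lift ::
    "('a, 'r) ring_scheme \<Rightarrow> ('a, 'b, 'm) module_scheme \<Rightarrow> ('x \<Rightarrow> 'b) \<Rightarrow> ('x \<Rightarrow> 'a) \<Rightarrow> 'b"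
  where "free_lift R M h f = (\<Oplus>\<^bsub>M\<^esub>x\<in>{x. f x \<noteq> \<zero>\<^bsub>R\<^esub>}. f x \<odot>\<^bsub>M\<^esub> h x)"

context
  fixes R (structure) and M (structure) and X and h
  assumes module: "module R M" and h: "h \<in> X \<rightarrow> carrier M"
begin

interpretation M: module R M by (rule module)
interpretation F: module R "free_module R X" by (rule M.module_free_module)

private lemma h_closed: "x \<in> X \<Longrightarrow> h x \<in> carrier M"
  using h by auto

text \<open>Additivity compares sums over the different supports of \<open>f\<close>, \<open>g\<close> and \<open>f + g\<close>; enlarging
  the index set to any finite set that contains the support makes them comparable.\<close>

lemma free_lift_eq:
  assumes "f \<in> carrier (free_module R X)" "finite A" "{x. f x \<noteq> \<zero>} \<subseteq> A" "A \<subseteq> X"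
  shows "free_lift R M h f = (\<Oplus>\<^bsub>M\<^esub>x\<in>A. f x \<odot>\<^bsub>M\<^esub> h x)"
  unfolding free_lift_def
proof (rule M.add.finprod_mono_neutral_cong_left)
  show "(\<lambda>x. f x \<odot>\<^bsub>M\<^esub> h x) \<in> A \<rightarrow> carrier M"
    using assms h_closed by (auto simp: free_module_def subset_iff)
qed (use assms h_closed in \<open>auto simp: subset_iff\<close>)

lemma free_lift_linear: "free_lift R M h \<in> linear_maps R (free_module R X) M"
proof (rule linear_mapsI)
  have supp: "finite {x. f x \<noteq> \<zero>}" "{x. f x \<noteq> \<zero>} \<subseteq> X" "\<And>x. f x \<in> carrier R"
    if "f \<in> carrier (free_module R X)" for f
    using that by (auto simp: free_module_def)
  fix f assume f: "f \<in> carrier (free_module R X)"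
  note sf = supp[OF f]
  show "free_lift R M h f \<in> carrier M"
    unfolding free_lift_def using sf h_closed by (intro M.finsum_closed) (auto simp: subset_iff)
  {
    fix g assume g: "g \<in> carrier (free_module R X)"
    note sg = supp[OF g]
    let ?A = "{x. f x \<noteq> \<zero>} \<union> {x. g x \<noteq> \<zero>}"
    have fg: "f \<oplus>\<^bsub>free_module R X\<^esub> g \<in> carrier (free_module R X)"
      using f g by (rule F.a_closed)
    have "free_lift R M h (f \<oplus>\<^bsub>free_module R X\<^esub> g) =
        (\<Oplus>\<^bsub>M\<^esub>x\<in>?A. (f \<oplus>\<^bsub>free_module R X\<^esub> g) x \<odot>\<^bsub>M\<^esub> h x)"
      using sf sg by (intro free_lift_eq[OF fg]) (auto simp: free_module_def)
    also have "\<dots> = (\<Oplus>\<^bsub>M\<^esub>x\<in>?A. f x \<odot>\<^bsub>M\<^esub> h x \<oplus>\<^bsub>M\<^esub> g x \<odot>\<^bsub>M\<^esub> h x)"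
      using sf sg h_closed
      by (intro M.finsum_cong')
        (auto simp: free_module_def M.smult_l_distr Pi_def subset_iff)
    also have "\<dots> = (\<Oplus>\<^bsub>M\<^esub>x\<in>?A. f x \<odot>\<^bsub>M\<^esub> h x) \<oplus>\<^bsub>M\<^esub> (\<Oplus>\<^bsub>M\<^esub>x\<in>?A. g x \<odot>\<^bsub>M\<^esub> h x)"
      using sf sg h_closed by (intro M.finsum_addf) (auto simp: Pi_def subset_iff)
    also have "\<dots> = free_lift R M h f \<oplus>\<^bsub>M\<^esub> free_lift R M h g"
      using sf sg by (subst (1 2) free_lift_eq[where A = ?A]) (use f g in auto)
    finally show "free_lift R M h (f \<oplus>\<^bsub>free_module R X\<^esub> g) =
        free_lift R M h f \<oplus>\<^bsub>M\<^esub> free_lift R M h g" .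
  }
  fix a assume a: "a \<in> carrier R"
  have af: "a \<odot>\<^bsub>free_module R X\<^esub> f \<in> carrier (free_module R X)"
    using a f by (rule F.smult_closed)
  let ?A = "{x. f x \<noteq> \<zero>}"
  have "free_lift R M h (a \<odot>\<^bsub>free_module R X\<^esub> f) =
      (\<Oplus>\<^bsub>M\<^esub>x\<in>?A. (a \<odot>\<^bsub>free_module R X\<^esub> f) x \<odot>\<^bsub>M\<^esub> h x)"
    using sf a by (intro free_lift_eq[OF af]) (auto simp: free_module_def)
  also have "\<dots> = (\<Oplus>\<^bsub>M\<^esub>x\<in>?A. a \<odot>\<^bsub>M\<^esub> (f x \<odot>\<^bsub>M\<^esub> h x))"
    using sf h_closed a
    by (intro M.finsum_cong') (auto simp: free_module_def M.smult_assoc1 Pi_def subset_iff)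
  also have "\<dots> = a \<odot>\<^bsub>M\<^esub> free_lift R M h f"
    unfolding free_lift_def
    using sf h_closed a by (intro M.finsum_smult_ldistr[symmetric]) (auto simp: Pi_def subset_iff)
  finally show "free_lift R M h (a \<odot>\<^bsub>free_module R X\<^esub> f) = a \<odot>\<^bsub>M\<^esub> free_lift R M h f" .
qed

lemma free_lift_gen:
  assumes "x \<in> X"
  shows "free_lift R M h (free_gen R x) = h x"
proof -
  have "free_lift R M h (free_gen R x) = (\<Oplus>\<^bsub>M\<^esub>y\<in>{x}. free_gen R x y \<odot>\<^bsub>M\<^esub> h y)"
    using assms by (intro free_lift_eq M.free_gen_closed) (auto simp: free_gen_def)
  also have "\<dots> = h x"
    using assms h_closed by (auto simp: free_gen_def M.finsum_insert)
  finally show ?thesis .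
qed

end

section \<open>Generated submodules and quotients\<close>

context module
begin

lemma submodule_zero: "submodule N R M \<Longrightarrow> \<zero>\<^bsub>M\<^esub> \<in> N"
  using subgroup.one_closed[of N "add_monoid M"] by (simp add: submodule_def)

lemma submodule_generated_submodule:
  assumes "S \<subseteq> carrier M"
  shows "submodule (submodule_generated R M S) R M"
proof (rule submoduleI)
  show "submodule_generated R M S \<subseteq> carrier M"
    using assms carrier_is_submodule by (auto simp: submodule_generated_def)
qed (auto simp: submodule_generated_def submodule_zero submoduleE)

lemma submodule_generated_incl: "S \<subseteq> submodule_generated R M S"
  by (auto simp: submodule_generated_def)

lemma submodule_generated_least:
  "submodule N R M \<Longrightarrow> S \<subseteq> N \<Longrightarrow> submodule_generated R M S \<subseteq> N"
  by (auto simp: submodule_generated_def)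

lemma kernel_submodule:
  assumes "module R P" "f \<in> linear_maps R M P"
  shows "submodule {x \<in> carrier M. f x = \<zero>\<^bsub>P\<^esub>} R M"
proof -
  interpret P: module R P by fact
  note f = linear_maps_add[OF assms(2)] linear_maps_smult[OF assms(2)]
    linear_maps_zero[OF module_axioms assms]
  show ?thesis
  proof (rule submoduleI)
    fix x assume "x \<in> {x \<in> carrier M. f x = \<zero>\<^bsub>P\<^esub>}"
    then show "\<ominus>\<^bsub>M\<^esub> x \<in> {x \<in> carrier M. f x = \<zero>\<^bsub>P\<^esub>}"
      using linear_maps_minus[OF module_axioms assms, of "\<zero>\<^bsub>M\<^esub>" x] f
      by (simp add: a_minus_def)
  qed (auto simp: f)
qed

context
  fixes N assumes N: "submodule N R M"
begin

interpretation N: abelian_subgroup N M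
  by (rule abelian_subgroupI3)
    (use N in \<open>auto simp: additive_subgroup_def submodule_def intro: M.abelian_group_axioms\<close>)

lemma quotient_add:
  "\<lbrakk>x \<in> carrier M; y \<in> carrier M\<rbrakk> \<Longrightarrow>
    (N +>\<^bsub>M\<^esub> x) \<oplus>\<^bsub>quotient_module M N\<^esub> (N +>\<^bsub>M\<^esub> y) = N +>\<^bsub>M\<^esub> (x \<oplus>\<^bsub>M\<^esub> y)"
  by (simp add: quotient_module_def N.a_rcos_sum)

lemma coset_eq_iff:
  assumes "x \<in> carrier M" "y \<in> carrier M"
  shows "N +>\<^bsub>M\<^esub> x = N +>\<^bsub>M\<^esub> y \<longleftrightarrow> x \<ominus>\<^bsub>M\<^esub> y \<in> N"
  using assms
  by (metis N.a_rcos_module N.a_repr_independence' N.a_repr_independenceD a_minus_def)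

text \<open>The union in the definition of the scalar multiplication runs over cosets that all
  coincide, since \<open>N\<close> is closed under scalars.\<close>

lemma quotient_smult:
  assumes "a \<in> carrier R" "x \<in> carrier M"
  shows "a \<odot>\<^bsub>quotient_module M N\<^esub> (N +>\<^bsub>M\<^esub> x) = N +>\<^bsub>M\<^esub> (a \<odot>\<^bsub>M\<^esub> x)"
proof -
  have "N +>\<^bsub>M\<^esub> (a \<odot>\<^bsub>M\<^esub> y) = N +>\<^bsub>M\<^esub> (a \<odot>\<^bsub>M\<^esub> x)" if y: "y \<in> N +>\<^bsub>M\<^esub> x" for y
  proof -
    have "y \<in> carrier M" "y \<oplus>\<^bsub>M\<^esub> \<ominus>\<^bsub>M\<^esub> x \<in> N"
      using y assms N.a_elemrcos_carrier N.a_rcos_module_imp by auto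
    with assms submoduleE(4)[OF N assms(1), of "y \<oplus>\<^bsub>M\<^esub> \<ominus>\<^bsub>M\<^esub> x"] show ?thesis
      by (subst coset_eq_iff) (auto simp: smult_r_distr smult_r_minus a_minus_def)
  qed
  then have "(\<Union>y\<in>N +>\<^bsub>M\<^esub> x. N +>\<^bsub>M\<^esub> (a \<odot>\<^bsub>M\<^esub> y)) = N +>\<^bsub>M\<^esub> (a \<odot>\<^bsub>M\<^esub> x)"
    by (intro UN_constant_eq[of x] N.a_rcos_self assms(2) ballI)
  then show ?thesis unfolding quotient_module_def by simp
qed

lemma quotient_carrier: "carrier (quotient_module M N) = (\<lambda>x. N +>\<^bsub>M\<^esub> x) ` carrier M"
  by (auto simp: quotient_module_def A_RCOSETS_def')

lemma quotient_zero: "\<zero>\<^bsub>quotient_module M N\<^esub> = N +>\<^bsub>M\<^esub> \<zero>\<^bsub>M\<^esub>"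
  using N.a_subset by (simp add: quotient_module_def)

lemma module_quotient_module: "module R (quotient_module M N)" (is "module R ?Q")
proof (rule moduleI)
  show "cring R" by (rule is_cring)
  show "abelian_group ?Q"
  proof (rule abelian_groupI)
    fix A assume "A \<in> carrier ?Q"
    then obtain x where x: "x \<in> carrier M" "A = N +>\<^bsub>M\<^esub> x" by (auto simp: quotient_carrier)
    then have "(N +>\<^bsub>M\<^esub> (\<ominus>\<^bsub>M\<^esub> x)) \<oplus>\<^bsub>?Q\<^esub> A = \<zero>\<^bsub>?Q\<^esub>"
      by (simp add: quotient_add quotient_zero l_neg)
    with x show "\<exists>B\<in>carrier ?Q. B \<oplus>\<^bsub>?Q\<^esub> A = \<zero>\<^bsub>?Q\<^esub>" by (auto simp: quotient_carrier)
  qed (auto simp: quotient_carrier quotient_add quotient_zero a_ac)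
qed (auto simp: quotient_carrier quotient_add quotient_smult smult_l_distr smult_r_distr smult_assoc1)

lemma quotient_proj_linear: "(\<lambda>x. N +>\<^bsub>M\<^esub> x) \<in> linear_maps R M (quotient_module M N)"
  by (rule linear_mapsI) (auto simp: quotient_carrier quotient_add quotient_smult)

lemma quotient_lift:
  assumes "module R P" "f \<in> linear_maps R M P" "\<And>x. x \<in> N \<Longrightarrow> f x = \<zero>\<^bsub>P\<^esub>"
  obtains g where "g \<in> linear_maps R (quotient_module M N) P"
    and "\<And>x. x \<in> carrier M \<Longrightarrow> g (N +>\<^bsub>M\<^esub> x) = f x"
proof -
  interpret P: module R P by fact
  note f = linear_maps_closed[OF assms(2)] linear_maps_add[OF assms(2)] linear_maps_smult[OF assms(2)]
  define g where "g A = f (SOME x. x \<in> carrier M \<and> A = N +>\<^bsub>M\<^esub> x)" for A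
  have g: "g (N +>\<^bsub>M\<^esub> x) = f x" if x: "x \<in> carrier M" for x
  proof -
    define y where "y = (SOME y. y \<in> carrier M \<and> N +>\<^bsub>M\<^esub> x = N +>\<^bsub>M\<^esub> y)"
    have y: "y \<in> carrier M \<and> N +>\<^bsub>M\<^esub> x = N +>\<^bsub>M\<^esub> y"
      unfolding y_def by (rule someI[where x = x]) (simp add: x)
    with x have "x \<ominus>\<^bsub>M\<^esub> y \<in> N" by (metis coset_eq_iff)
    then have "f x \<ominus>\<^bsub>P\<^esub> f y = \<zero>\<^bsub>P\<^esub>"
      using assms(3) linear_maps_minus[OF module_axioms assms(1,2) x, of y] y by simp
    then have "f x = f y" using x y f(1) by (simp add: P.minus_eq_zero_iff)
    then show ?thesis by (simp add: g_def y_def)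
  qed
  have "g \<in> linear_maps R (quotient_module M N) P"
    by (rule linear_mapsI) (auto simp: quotient_carrier quotient_add quotient_smult g f)
  with g show ?thesis by (intro that)
qed

end

end

section \<open>Tensor products\<close>

context
  fixes R (structure) and V (structure) and W (structure)
  assumes V: "module R V" and W: "module R W"
begin

interpretation V: module R V by (rule V)
interpretation W: module R W by (rule W)
interpretation F: module R "free_module R (carrier V \<times> carrier W)" by (rule V.module_free_module)

lemma tensor_relations_closed:
  "tensor_relations R V W \<subseteq> carrier (free_module R (carrier V \<times> carrier W))"
  by (auto simp: tensor_relations_def Let_def intro!: F.minus_closed V.free_gen_closed)

lemma tensor_kernel_submodule:
  "submodule (tensor_kernel R V W) R (free_module R (carrier V \<times> carrier W))"
  unfolding tensor_kernel_def
  by (rule F.submodule_generated_submodule[OF tensor_relations_closed])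

lemma module_tensor: "module R (tensor R V W)"
  unfolding tensor_def by (rule F.module_quotient_module[OF tensor_kernel_submodule])

interpretation T: module R "tensor R V W" by (rule module_tensor)

lemma tensor_proj_linear:
  "(\<lambda>f. tensor_kernel R V W +>\<^bsub>free_module R (carrier V \<times> carrier W)\<^esub> f)
    \<in> linear_maps R (free_module R (carrier V \<times> carrier W)) (tensor R V W)"
  unfolding tensor_def by (rule F.quotient_proj_linear[OF tensor_kernel_submodule])

text \<open>Each bilinearity law states that a difference of two elements of the free module is one of the
  defining relations, so that the two elements have the same coset.\<close>

lemma pure_tensor_bilinear: "pure_tensor R V W \<in> bilinear_maps R V W (tensor R V W)"
proof -
  let ?F = "free_module R (carrier V \<times> carrier W)"
  let ?gen = "\<lambda>x y. free_gen R (x, y)"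
  note proj = linear_maps_closed[OF tensor_proj_linear] linear_maps_add[OF tensor_proj_linear]
    linear_maps_smult[OF tensor_proj_linear]
  have gen: "?gen x y \<in> carrier ?F" if "x \<in> carrier V" "y \<in> carrier W" for x y
    using that by (simp add: V.free_gen_closed)
  have eq: "tensor_kernel R V W +>\<^bsub>?F\<^esub> f = tensor_kernel R V W +>\<^bsub>?F\<^esub> g"
    if "f \<in> carrier ?F" "g \<in> carrier ?F" "f \<ominus>\<^bsub>?F\<^esub> g \<in> tensor_relations R V W" for f g
    using that F.coset_eq_iff[OF tensor_kernel_submodule, of f g]
      F.submodule_generated_incl[of "tensor_relations R V W"]
    by (auto simp: tensor_kernel_def)
  show ?thesis
  proof (rule bilinear_mapsI)
    fix x y assume xy: "x \<in> carrier V" "y \<in> carrier W"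
    show "pure_tensor R V W x y \<in> carrier (tensor R V W)"
      unfolding pure_tensor_def by (rule proj(1)[OF gen[OF xy]])
    show "pure_tensor R V W (x \<oplus>\<^bsub>V\<^esub> x') y =
        pure_tensor R V W x y \<oplus>\<^bsub>tensor R V W\<^esub> pure_tensor R V W x' y"
      if x': "x' \<in> carrier V" for x'
    proof -
      have "?gen (x \<oplus>\<^bsub>V\<^esub> x') y \<ominus>\<^bsub>?F\<^esub> (?gen x y \<oplus>\<^bsub>?F\<^esub> ?gen x' y) \<in> tensor_relations R V W"
        using xy x' unfolding tensor_relations_def Let_def by blast
      from eq[OF _ _ this] show ?thesis
        using xy x' by (simp add: pure_tensor_def proj(2)[symmetric] gen)
    qed
    show "pure_tensor R V W x (y \<oplus>\<^bsub>W\<^esub> y') =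
        pure_tensor R V W x y \<oplus>\<^bsub>tensor R V W\<^esub> pure_tensor R V W x y'"
      if y': "y' \<in> carrier W" for y'
    proof -
      have "?gen x (y \<oplus>\<^bsub>W\<^esub> y') \<ominus>\<^bsub>?F\<^esub> (?gen x y \<oplus>\<^bsub>?F\<^esub> ?gen x y') \<in> tensor_relations R V W"
        using xy y' unfolding tensor_relations_def Let_def by blast
      from eq[OF _ _ this] show ?thesis
        using xy y' by (simp add: pure_tensor_def proj(2)[symmetric] gen)
    qed
    show "pure_tensor R V W (a \<odot>\<^bsub>V\<^esub> x) y = a \<odot>\<^bsub>tensor R V W\<^esub> pure_tensor R V W x y"
      if a: "a \<in> carrier R" for a
    proof -
      have "?gen (a \<odot>\<^bsub>V\<^esub> x) y \<ominus>\<^bsub>?F\<^esub> (a \<odot>\<^bsub>?F\<^esub> ?gen x y) \<in> tensor_relations R V W"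
        using xy a unfolding tensor_relations_def Let_def by blast
      from eq[OF _ _ this] show ?thesis
        using xy a by (simp add: pure_tensor_def proj(3)[symmetric] gen)
    qed
    show "pure_tensor R V W x (a \<odot>\<^bsub>W\<^esub> y) = a \<odot>\<^bsub>tensor R V W\<^esub> pure_tensor R V W x y"
      if a: "a \<in> carrier R" for a
    proof -
      have "?gen x (a \<odot>\<^bsub>W\<^esub> y) \<ominus>\<^bsub>?F\<^esub> (a \<odot>\<^bsub>?F\<^esub> ?gen x y) \<in> tensor_relations R V W"
        using xy a unfolding tensor_relations_def Let_def by blast
      from eq[OF _ _ this] show ?thesis
        using xy a by (simp add: pure_tensor_def proj(3)[symmetric] gen)
    qed
  qed
qed

text \<open>A scalar multiple of a pure tensor is again pure, so finite sums of pure tensors exhaust the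
  tensor product.\<close>

lemma tensor_induct [consumes 1, case_names zero pure add]:
  assumes t: "t \<in> carrier (tensor R V W)"
    and zero: "P \<zero>\<^bsub>tensor R V W\<^esub>"
    and pure: "\<And>x y. x \<in> carrier V \<Longrightarrow> y \<in> carrier W \<Longrightarrow> P (pure_tensor R V W x y)"
    and add: "\<And>s t. s \<in> carrier (tensor R V W) \<Longrightarrow> t \<in> carrier (tensor R V W) \<Longrightarrow>
      P s \<Longrightarrow> P t \<Longrightarrow> P (s \<oplus>\<^bsub>tensor R V W\<^esub> t)"
  shows "P t"
proof -
  let ?F = "free_module R (carrier V \<times> carrier W)"
  define q where "q f = tensor_kernel R V W +>\<^bsub>?F\<^esub> f" for f
  have q: "q \<in> linear_maps R ?F (tensor R V W)"
    using tensor_proj_linear unfolding q_def .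
  have P: "P (q f)" if "f \<in> carrier ?F" for f
    using that
  proof (induction rule: V.free_module_induct)
    case zero
    show ?case
      using assms(2) by (simp add: linear_maps_zero[OF F.module_axioms T.module_axioms q])
  next
    case (gen a v)
    then obtain x y where v: "v = (x, y)" and xy: "x \<in> carrier V" "y \<in> carrier W" by auto
    have "q (a \<odot>\<^bsub>?F\<^esub> free_gen R v) = a \<odot>\<^bsub>tensor R V W\<^esub> pure_tensor R V W x y"
      using gen(1) xy
      by (simp add: v linear_maps_smult[OF q] V.free_gen_closed) (simp add: q_def pure_tensor_def)
    also have "\<dots> = pure_tensor R V W (a \<odot>\<^bsub>V\<^esub> x) y"
      using gen(1) xy by (simp add: bilinear_maps_smult_left[OF pure_tensor_bilinear])
    finally show ?case
      using pure gen(1) xy by simp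
  next
    case (add f g)
    then show ?case
      using assms(4) by (simp add: linear_maps_add[OF q] linear_maps_closed[OF q])
  qed
  from t obtain f where "f \<in> carrier ?F" "t = q f"
    by (auto simp: q_def tensor_def F.quotient_carrier[OF tensor_kernel_submodule])
  with P show ?thesis by simp
qed

lemma linear_maps_tensor_eqI:
  assumes M: "module R M"
    and f: "f \<in> linear_maps R (tensor R V W) M" and g: "g \<in> linear_maps R (tensor R V W) M"
    and eq: "\<And>x y. x \<in> carrier V \<Longrightarrow> y \<in> carrier W \<Longrightarrow>
      f (pure_tensor R V W x y) = g (pure_tensor R V W x y)"
    and t: "t \<in> carrier (tensor R V W)"
  shows "f t = g t"
  using t
proof (induction rule: tensor_induct)
  case zero
  show ?case
    by (simp add: linear_maps_zero[OF T.module_axioms M f] linear_maps_zero[OF T.module_axioms M g])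
next
  case (pure x y)
  then show ?case by (rule eq)
next
  case (add s t)
  then show ?case by (simp add: linear_maps_add[OF f] linear_maps_add[OF g])
qed

context
  fixes M and h
  assumes M: "module R M" and h: "h \<in> bilinear_maps R V W M"
begin

interpretation M: module R M by (rule M)

text \<open>The linear extension of \<open>h\<close> to the free module kills each defining relation because \<open>h\<close> is
  bilinear, hence it kills the submodule that they generate and descends to the quotient.\<close>

lemma tensor_universal:
  "\<exists>f \<in> linear_maps R (tensor R V W) M.
    \<forall>x\<in>carrier V. \<forall>y\<in>carrier W. f (pure_tensor R V W x y) = h x y"
proof -
  let ?F = "free_module R (carrier V \<times> carrier W)"
  let ?gen = "\<lambda>x y. free_gen R (x, y)"
  define f where "f = free_lift R M (\<lambda>(x, y). h x y)"
  have hM: "(\<lambda>(x, y). h x y) \<in> carrier V \<times> carrier W \<rightarrow> carrier M"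
    using bilinear_maps_closed[OF h] by auto
  have f: "f \<in> linear_maps R ?F M"
    unfolding f_def by (rule free_lift_linear[OF M hM])
  have f_gen: "f (?gen x y) = h x y" if "x \<in> carrier V" "y \<in> carrier W" for x y
    using that by (simp add: f_def free_lift_gen[OF M hM])
  have gen: "?gen x y \<in> carrier ?F" if "x \<in> carrier V" "y \<in> carrier W" for x y
    using that by (simp add: V.free_gen_closed)
  have "tensor_relations R V W \<subseteq> {v \<in> carrier ?F. f v = \<zero>\<^bsub>M\<^esub>}"
    by (auto simp: tensor_relations_def Let_def gen f_gen M.minus_eq_zero_iff
        linear_maps_minus[OF F.module_axioms M f] linear_maps_add[OF f] linear_maps_smult[OF f]
        bilinear_maps_simps[OF h])
  then have "tensor_kernel R V W \<subseteq> {v \<in> carrier ?F. f v = \<zero>\<^bsub>M\<^esub>}"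
    unfolding tensor_kernel_def
    by (rule F.submodule_generated_least[OF F.kernel_submodule[OF M f]])
  then obtain g where "g \<in> linear_maps R (tensor R V W) M"
    and "\<And>v. v \<in> carrier ?F \<Longrightarrow> g (tensor_kernel R V W +>\<^bsub>?F\<^esub> v) = f v"
    using F.quotient_lift[OF tensor_kernel_submodule M f] unfolding tensor_def by blast
  then show ?thesis
    by (intro bexI[of _ g]) (simp_all add: pure_tensor_def gen f_gen)
qed

lemma tensor_lift_ex1:
  "\<exists>!f. f \<in> linear_maps R (tensor R V W) M \<inter> extensional (carrier (tensor R V W)) \<and>
    (\<forall>x\<in>carrier V. \<forall>y\<in>carrier W. f (pure_tensor R V W x y) = h x y)"
proof -
  obtain g where g: "g \<in> linear_maps R (tensor R V W) M"
    and g_pure: "\<forall>x\<in>carrier V. \<forall>y\<in>carrier W. g (pure_tensor R V W x y) = h x y"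
    using tensor_universal by blast
  show ?thesis
  proof (rule ex1I[of _ "restrict g (carrier (tensor R V W))"])
    fix f
    assume f: "f \<in> linear_maps R (tensor R V W) M \<inter> extensional (carrier (tensor R V W)) \<and>
      (\<forall>x\<in>carrier V. \<forall>y\<in>carrier W. f (pure_tensor R V W x y) = h x y)"
    have "f t = g t" if "t \<in> carrier (tensor R V W)" for t
      by (rule linear_maps_tensor_eqI[OF M _ g _ that]) (use f g_pure in auto)
    with f show "f = restrict g (carrier (tensor R V W))"
      by (intro extensionalityI[of _ "carrier (tensor R V W)"]) auto
  qed (auto simp: linear_maps_restrict[OF T.module_axioms g] g_pure
      bilinear_maps_closed[OF pure_tensor_bilinear])
qed

lemma tensor_lift_linear: "tensor_lift R V W M h \<in> linear_maps R (tensor R V W) M"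
  and tensor_lift_pure: "\<lbrakk>x \<in> carrier V; y \<in> carrier W\<rbrakk> \<Longrightarrow>
    tensor_lift R V W M h (pure_tensor R V W x y) = h x y"
  using theI'[OF tensor_lift_ex1] unfolding tensor_lift_def by blast+

end

text \<open>A trilinear map \<open>h\<close>, lifted in its last two arguments, is still bilinear; both directions of
  the associator are obtained by lifting such a map a second time.\<close>

lemma tensor_lift_bilinear:
  assumes U: "module R U" and M: "module R M"
    and h: "\<And>x. x \<in> carrier U \<Longrightarrow> h x \<in> bilinear_maps R V W M"
    and lin: "\<And>y z. \<lbrakk>y \<in> carrier V; z \<in> carrier W\<rbrakk> \<Longrightarrow> (\<lambda>x. h x y z) \<in> linear_maps R U M"
  shows "(\<lambda>x. tensor_lift R V W M (h x)) \<in> bilinear_maps R U (tensor R V W) M"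
proof -
  interpret U: module R U by (rule U)
  interpret M: module R M by (rule M)
  note lift = tensor_lift_linear[OF M h]
  have cong: "f \<in> linear_maps R U M"
    if "g \<in> linear_maps R U M" "\<And>x. x \<in> carrier U \<Longrightarrow> f x = g x" for f g
    using that by (auto simp: linear_maps_def Pi_iff)
  have "(\<lambda>x. tensor_lift R V W M (h x) t) \<in> linear_maps R U M" if "t \<in> carrier (tensor R V W)" for t
    using that
  proof (induction rule: tensor_induct)
    case zero
    show ?case
      by (rule cong[OF linear_maps_zero_map[OF U M]])
        (rule linear_maps_zero[OF T.module_axioms M lift])
  next
    case (pure y z)
    then show ?case
      by (intro cong[OF lin]) (simp_all add: tensor_lift_pure[OF M h])
  next
    case (add s t)
    show ?case
      by (rule cong[OF linear_maps_plus[OF U M add.IH]])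
        (rule linear_maps_add[OF lift add.hyps])
  qed
  with lift show ?thesis by (simp add: bilinear_maps_def)
qed

end

context
  fixes R (structure) and V and W and V' and W' and f and g
  assumes modules: "module R V" "module R W" "module R V'" "module R W'"
    and f: "f \<in> linear_maps R V V'" and g: "g \<in> linear_maps R W W'"
begin

lemma tensor_map_bilinear:
  "(\<lambda>x y. pure_tensor R V' W' (f x) (g y)) \<in> bilinear_maps R V W (tensor R V' W')"
  using bilinear_maps_comp[OF pure_tensor_bilinear[OF modules(3,4)] f g linear_maps_id] .

lemma tensor_map_linear:
  "tensor_map R V W V' W' f g \<in> linear_maps R (tensor R V W) (tensor R V' W')"
  unfolding tensor_map_def
  by (rule tensor_lift_linear[OF modules(1,2) module_tensor[OF modules(3,4)] tensor_map_bilinear])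

lemma tensor_map_pure:
  "\<lbrakk>x \<in> carrier V; y \<in> carrier W\<rbrakk> \<Longrightarrow>
    tensor_map R V W V' W' f g (pure_tensor R V W x y) = pure_tensor R V' W' (f x) (g y)"
  unfolding tensor_map_def
  by (rule tensor_lift_pure[OF modules(1,2) module_tensor[OF modules(3,4)] tensor_map_bilinear])

end

section \<open>The associator\<close>

context
  fixes R (structure) and U and V and W
  assumes U: "module R U" and V: "module R V" and W: "module R W"
begin

private lemmas UV = module_tensor[OF U V]
private lemmas VW = module_tensor[OF V W]
private lemmas UV_W = module_tensor[OF UV W]
private lemmas U_VW = module_tensor[OF U VW]
private lemmas pure_bilinear =
  pure_tensor_bilinear[OF U V] pure_tensor_bilinear[OF V W]
  pure_tensor_bilinear[OF UV W] pure_tensor_bilinear[OF U VW]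
private lemmas pure_simps = pure_bilinear[THEN bilinear_maps_closed]
  pure_bilinear[THEN bilinear_maps_add_left] pure_bilinear[THEN bilinear_maps_add_right]
  pure_bilinear[THEN bilinear_maps_smult_left] pure_bilinear[THEN bilinear_maps_smult_right]

lemma triple_tensor_right_bilinear:
  "z \<in> carrier W \<Longrightarrow>
    (\<lambda>x y. pure_tensor R U (tensor R V W) x (pure_tensor R V W y z))
      \<in> bilinear_maps R U V (tensor R U (tensor R V W))"
  "x \<in> carrier U \<Longrightarrow> y \<in> carrier V \<Longrightarrow>
    (\<lambda>z. pure_tensor R U (tensor R V W) x (pure_tensor R V W y z))
      \<in> linear_maps R W (tensor R U (tensor R V W))"
  by (auto intro!: bilinear_mapsI linear_mapsI simp: pure_simps)

lemma triple_tensor_left_bilinear: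
  "x \<in> carrier U \<Longrightarrow>
    (\<lambda>y z. pure_tensor R (tensor R U V) W (pure_tensor R U V x y) z)
      \<in> bilinear_maps R V W (tensor R (tensor R U V) W)"
  "y \<in> carrier V \<Longrightarrow> z \<in> carrier W \<Longrightarrow>
    (\<lambda>x. pure_tensor R (tensor R U V) W (pure_tensor R U V x y) z)
      \<in> linear_maps R U (tensor R (tensor R U V) W)"
  by (auto intro!: bilinear_mapsI linear_mapsI simp: pure_simps)

text \<open>With the first factor fixed, both maps are linear in the second one, so the comparison on
  pure tensors can be carried out one tensor product at a time.\<close>

lemma linear_maps_triple_eqI:
  assumes M: "module R M"
    and f: "f \<in> linear_maps R (tensor R U (tensor R V W)) M"
    and g: "g \<in> linear_maps R (tensor R U (tensor R V W)) M"
    and eq: "\<And>x y z. \<lbrakk>x \<in> carrier U; y \<in> carrier V; z \<in> carrier W\<rbrakk> \<Longrightarrow>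
      f (pure_tensor R U (tensor R V W) x (pure_tensor R V W y z)) =
      g (pure_tensor R U (tensor R V W) x (pure_tensor R V W y z))"
    and t: "t \<in> carrier (tensor R U (tensor R V W))"
  shows "f t = g t"
proof (rule linear_maps_tensor_eqI[OF U VW M f g _ t])
  fix x s assume x: "x \<in> carrier U" and s: "s \<in> carrier (tensor R V W)"
  note p = bilinear_maps_right[OF pure_tensor_bilinear[OF U VW] x]
  show "f (pure_tensor R U (tensor R V W) x s) = g (pure_tensor R U (tensor R V W) x s)"
    using linear_maps_tensor_eqI[OF V W M linear_maps_comp[OF p f] linear_maps_comp[OF p g] _ s]
      eq[OF x] by simp
qed

lemma linear_maps_triple_left_eqI:
  assumes M: "module R M"
    and f: "f \<in> linear_maps R (tensor R (tensor R U V) W) M"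
    and g: "g \<in> linear_maps R (tensor R (tensor R U V) W) M"
    and eq: "\<And>x y z. \<lbrakk>x \<in> carrier U; y \<in> carrier V; z \<in> carrier W\<rbrakk> \<Longrightarrow>
      f (pure_tensor R (tensor R U V) W (pure_tensor R U V x y) z) =
      g (pure_tensor R (tensor R U V) W (pure_tensor R U V x y) z)"
    and t: "t \<in> carrier (tensor R (tensor R U V) W)"
  shows "f t = g t"
proof (rule linear_maps_tensor_eqI[OF UV W M f g _ t])
  fix s z assume z: "z \<in> carrier W" and s: "s \<in> carrier (tensor R U V)"
  note p = bilinear_maps_left[OF pure_tensor_bilinear[OF UV W] z]
  show "f (pure_tensor R (tensor R U V) W s z) = g (pure_tensor R (tensor R U V) W s z)"
    using linear_maps_tensor_eqI[OF U V M linear_maps_comp[OF p f] linear_maps_comp[OF p g] _ s]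
      eq[OF _ _ z] by simp
qed

lemma tensor_assoc_linear:
    "tensor_assoc R U V W
      \<in> linear_maps R (tensor R (tensor R U V) W) (tensor R U (tensor R V W))"
  and tensor_assoc_pure:
    "\<lbrakk>x \<in> carrier U; y \<in> carrier V; z \<in> carrier W\<rbrakk> \<Longrightarrow>
      tensor_assoc R U V W (pure_tensor R (tensor R U V) W (pure_tensor R U V x y) z) =
      pure_tensor R U (tensor R V W) x (pure_tensor R V W y z)"
proof -
  note b = bilinear_maps_flip[OF tensor_lift_bilinear[OF U V W U_VW triple_tensor_right_bilinear]]
  show "tensor_assoc R U V W
      \<in> linear_maps R (tensor R (tensor R U V) W) (tensor R U (tensor R V W))"
    unfolding tensor_assoc_def by (rule tensor_lift_linear[OF UV W U_VW b])
  show "tensor_assoc R U V W (pure_tensor R (tensor R U V) W (pure_tensor R U V x y) z) =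
      pure_tensor R U (tensor R V W) x (pure_tensor R V W y z)"
    if "x \<in> carrier U" "y \<in> carrier V" "z \<in> carrier W"
    unfolding tensor_assoc_def using that
    by (simp add: tensor_lift_pure[OF UV W U_VW b] pure_simps
        tensor_lift_pure[OF U V U_VW triple_tensor_right_bilinear(1)])
qed

text \<open>A two-sided inverse \<open>g\<close> of the associator on the carriers is built from the universal
  property; it agrees with the choice function \<open>inv_into\<close>, which thereby becomes linear and
  computable on pure tensors.\<close>

lemma tensor_assoc_inverse:
  defines "i \<equiv> inv_into (carrier (tensor R (tensor R U V) W)) (tensor_assoc R U V W)"
  obtains g where
    "g \<in> linear_maps R (tensor R U (tensor R V W)) (tensor R (tensor R U V) W)"
    "\<And>x y z. \<lbrakk>x \<in> carrier U; y \<in> carrier V; z \<in> carrier W\<rbrakk> \<Longrightarrow>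
      g (pure_tensor R U (tensor R V W) x (pure_tensor R V W y z)) =
      pure_tensor R (tensor R U V) W (pure_tensor R U V x y) z"
    "\<And>t. t \<in> carrier (tensor R U (tensor R V W)) \<Longrightarrow> i t = g t"
proof -
  let ?a = "tensor_assoc R U V W"
  let ?l = "tensor R (tensor R U V) W" and ?r = "tensor R U (tensor R V W)"
  note b = tensor_lift_bilinear[OF V W U UV_W triple_tensor_left_bilinear]
  define g where "g = tensor_lift R U (tensor R V W) ?l (\<lambda>x. tensor_lift R V W ?l
    (\<lambda>y z. pure_tensor R (tensor R U V) W (pure_tensor R U V x y) z))"
  have g: "g \<in> linear_maps R ?r ?l"
    unfolding g_def by (rule tensor_lift_linear[OF U VW UV_W b])
  have g_pure: "g (pure_tensor R U (tensor R V W) x (pure_tensor R V W y z)) =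
      pure_tensor R (tensor R U V) W (pure_tensor R U V x y) z"
    if "x \<in> carrier U" "y \<in> carrier V" "z \<in> carrier W" for x y z
    unfolding g_def using that
    by (simp add: tensor_lift_pure[OF U VW UV_W b] pure_simps
        tensor_lift_pure[OF V W UV_W triple_tensor_left_bilinear(1)])
  have ga: "(g \<circ> ?a) t = t" if t: "t \<in> carrier ?l" for t
    by (rule linear_maps_triple_left_eqI[OF UV_W linear_maps_comp[OF tensor_assoc_linear g]
          linear_maps_id _ t])
      (simp add: tensor_assoc_pure g_pure)
  have ag: "(?a \<circ> g) t = t" if t: "t \<in> carrier ?r" for t
    by (rule linear_maps_triple_eqI[OF U_VW linear_maps_comp[OF g tensor_assoc_linear]
          linear_maps_id _ t])
      (simp add: tensor_assoc_pure g_pure)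
  have "inj_on ?a (carrier ?l)"
    using ga by (intro inj_on_inverseI[of _ g]) simp
  then have "i (?a (g t)) = g t" if "t \<in> carrier ?r" for t
    unfolding i_def using linear_maps_closed[OF g that] by (rule inv_into_f_f)
  with ag have "i t = g t" if "t \<in> carrier ?r" for t
    using that by simp
  with g g_pure show ?thesis by (rule that)
qed

end

section \<open>The Hom-Yang-Baxter operator of a Hom-Lie algebra\<close>

lemma twist_left_linear:
  assumes "module R V" "\<alpha> \<in> linear_maps R V V" "B \<in> linear_maps R (tensor R V V) (tensor R V V)"
  shows "twist_left R V \<alpha> B
    \<in> linear_maps R (tensor R V (tensor R V V)) (tensor R V (tensor R V V))"
  using assms unfolding twist_left_def by (intro tensor_map_linear module_tensor)

lemma twist_left_pure:
  assumes "module R V" "\<alpha> \<in> linear_maps R V V" "B \<in> linear_maps R (tensor R V V) (tensor R V V)"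
    and "x \<in> carrier V" "s \<in> carrier (tensor R V V)"
  shows "twist_left R V \<alpha> B (pure_tensor R V (tensor R V V) x s) =
    pure_tensor R V (tensor R V V) (\<alpha> x) (B s)"
  using assms unfolding twist_left_def by (intro tensor_map_pure module_tensor)

text \<open>On the carrier the transport along the associator is a composite of linear maps, whose values
  on pure triples are known; off the carrier \<open>inv_into\<close> is unspecified.\<close>

lemma
  assumes V: "module R V" and \<alpha>: "\<alpha> \<in> linear_maps R V V"
    and B: "B \<in> linear_maps R (tensor R V V) (tensor R V V)"
  shows twist_right_linear: "twist_right R V \<alpha> B
    \<in> linear_maps R (tensor R V (tensor R V V)) (tensor R V (tensor R V V))" (is ?lin)
    and twist_right_pure: "\<lbrakk>x \<in> carrier V; y \<in> carrier V; z \<in> carrier V\<rbrakk> \<Longrightarrow>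
      twist_right R V \<alpha> B (pure_tensor R V (tensor R V V) x (pure_tensor R V V y z)) =
      tensor_assoc R V V V
        (pure_tensor R (tensor R V V) V (B (pure_tensor R V V x y)) (\<alpha> z))"
proof -
  let ?i = "inv_into (carrier (tensor R (tensor R V V) V)) (tensor_assoc R V V V)"
  let ?r = "tensor R V (tensor R V V)"
  obtain g where g: "g \<in> linear_maps R ?r (tensor R (tensor R V V) V)"
    and g_pure: "\<And>x y z. \<lbrakk>x \<in> carrier V; y \<in> carrier V; z \<in> carrier V\<rbrakk> \<Longrightarrow>
      g (pure_tensor R V (tensor R V V) x (pure_tensor R V V y z)) =
      pure_tensor R (tensor R V V) V (pure_tensor R V V x y) z"
    and i: "\<And>t. t \<in> carrier ?r \<Longrightarrow> ?i t = g t"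
    using tensor_assoc_inverse[OF V V V] by blast
  let ?m = "tensor_map R (tensor R V V) V (tensor R V V) V B \<alpha>"
  note VV = module_tensor[OF V V]
  note pure = bilinear_maps_closed[OF pure_tensor_bilinear]
  interpret r: module R ?r by (rule module_tensor[OF V VV])
  have eq: "twist_right R V \<alpha> B t = (tensor_assoc R V V V \<circ> ?m \<circ> g) t" if "t \<in> carrier ?r" for t
    using that by (simp add: twist_right_def i)
  have lin: "tensor_assoc R V V V \<circ> ?m \<circ> g \<in> linear_maps R ?r ?r"
    by (intro linear_maps_comp[OF g] linear_maps_comp[OF tensor_map_linear[OF VV V VV V B \<alpha>]]
        tensor_assoc_linear V)
  show ?lin
    using linear_maps_closed[OF lin] linear_maps_add[OF lin] linear_maps_smult[OF lin]
    by (intro linear_mapsI) (simp_all only: eq r.a_closed r.smult_closed)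
  show "twist_right R V \<alpha> B (pure_tensor R V (tensor R V V) x (pure_tensor R V V y z)) =
      tensor_assoc R V V V
        (pure_tensor R (tensor R V V) V (B (pure_tensor R V V x y)) (\<alpha> z))"
    if "x \<in> carrier V" "y \<in> carrier V" "z \<in> carrier V"
    using that
    by (simp add: eq pure[OF V VV] pure[OF V V] g_pure tensor_map_pure[OF VV V VV V B \<alpha>])
qed

text \<open>The sign of the second summand of \<open>B\<close> is absorbed into the scalar \<open>n = -\<nu>\<close>, so that the
  expansion of the Hom-Yang-Baxter equation involves only sums and scalar multiples.\<close>

locale hom_lie_operator = hom_lie_algebra R L br \<alpha>
  for R (structure) and L (structure) and br and \<alpha> +
  fixes u l n B
  assumes u: "u \<in> hom_lie_center L br" and \<alpha>_u [simp]: "\<alpha> u = u"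
    and scalars [simp]: "l \<in> carrier R" "n \<in> carrier R"
    and B_linear: "B \<in> linear_maps R (tensor R L L) (tensor R L L)"
    and B_pure: "\<lbrakk>x \<in> carrier L; y \<in> carrier L\<rbrakk> \<Longrightarrow>
      B (pure_tensor R L L x y) =
        l \<odot>\<^bsub>tensor R L L\<^esub> pure_tensor R L L (br x y) u
          \<oplus>\<^bsub>tensor R L L\<^esub> n \<odot>\<^bsub>tensor R L L\<^esub> pure_tensor R L L (\<alpha> y) (\<alpha> x)"
begin

abbreviation "L2 \<equiv> tensor R L L"
abbreviation "L3 \<equiv> tensor R L L2"
abbreviation "p2 x y \<equiv> pure_tensor R L L x y"

text \<open>Pure triples are folded into a constant so that the rewrite rules for \<open>\<alpha> \<otimes> B\<close> and
  \<open>B \<otimes> \<alpha>\<close> apply to them as a whole.\<close>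

definition "p3 x y z = pure_tensor R L L2 x (p2 y z)"

lemmas modL = L.module_axioms
lemmas modL2 = module_tensor[OF modL modL]
lemmas modL3 = module_tensor[OF modL modL2]

sublocale L2: module R L2 by (rule modL2)
sublocale L3: module R L3 by (rule modL3)

lemmas p_bilinear = pure_tensor_bilinear[OF modL modL] pure_tensor_bilinear[OF modL modL2]

lemma u_closed [simp]: "u \<in> carrier L"
  using u by (simp add: hom_lie_center_def)

lemmas \<alpha>_closed [simp] = linear_maps_closed[OF \<alpha>_linear]
lemmas br_closed [simp] = bilinear_maps_closed[OF br_bilinear]

lemma br_u [simp]: "x \<in> carrier L \<Longrightarrow> br u x = \<zero>\<^bsub>L\<^esub>"
  using u by (simp add: hom_lie_center_def)

lemma br_u_right [simp]: "x \<in> carrier L \<Longrightarrow> br x u = \<zero>\<^bsub>L\<^esub>"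
  using br_skew[of x u] by simp

lemmas p2_closed [simp] = bilinear_maps_closed[OF p_bilinear(1)]

lemma p3_closed [simp]:
  "\<lbrakk>x \<in> carrier L; y \<in> carrier L; z \<in> carrier L\<rbrakk> \<Longrightarrow> p3 x y z \<in> carrier L3"
  by (simp add: p3_def bilinear_maps_closed[OF p_bilinear(2)])

lemma p3_zero [simp]:
  assumes "y \<in> carrier L" "z \<in> carrier L"
  shows "p3 y \<zero>\<^bsub>L\<^esub> z = \<zero>\<^bsub>L3\<^esub>"
  using linear_maps_zero[OF modL modL2 bilinear_maps_left[OF p_bilinear(1)]]
    linear_maps_zero[OF modL2 modL3 bilinear_maps_right[OF p_bilinear(2)]] assms
  by (simp add: p3_def)

lemma p3_add:
  assumes "x \<in> carrier L" "x' \<in> carrier L" "y \<in> carrier L" "z \<in> carrier L"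
  shows "p3 (x \<oplus>\<^bsub>L\<^esub> x') y z = p3 x y z \<oplus>\<^bsub>L3\<^esub> p3 x' y z"
  using assms by (simp add: p3_def bilinear_maps_add_left[OF p_bilinear(2)])

abbreviation "\<alpha>B \<equiv> twist_left R L \<alpha> B"
abbreviation "B\<alpha> \<equiv> twist_right R L \<alpha> B"

lemma alpha_B_linear: "\<alpha>B \<in> linear_maps R L3 L3"
  by (rule twist_left_linear[OF modL \<alpha>_linear B_linear])

lemma B_alpha_linear: "B\<alpha> \<in> linear_maps R L3 L3"
  by (rule twist_right_linear[OF modL \<alpha>_linear B_linear])

lemma alpha_B_p3:
  assumes "x \<in> carrier L" "y \<in> carrier L" "z \<in> carrier L"
  shows "\<alpha>B (p3 x y z) =
    l \<odot>\<^bsub>L3\<^esub> p3 (\<alpha> x) (br y z) u \<oplus>\<^bsub>L3\<^esub> n \<odot>\<^bsub>L3\<^esub> p3 (\<alpha> x) (\<alpha> z) (\<alpha> y)"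
  using assms
  by (simp add: p3_def twist_left_pure[OF modL \<alpha>_linear B_linear] B_pure
      bilinear_maps_simps[OF p_bilinear(2)])

lemma B_alpha_p3:
  assumes "x \<in> carrier L" "y \<in> carrier L" "z \<in> carrier L"
  shows "B\<alpha> (p3 x y z) =
    l \<odot>\<^bsub>L3\<^esub> p3 (br x y) u (\<alpha> z) \<oplus>\<^bsub>L3\<^esub> n \<odot>\<^bsub>L3\<^esub> p3 (\<alpha> y) (\<alpha> x) (\<alpha> z)"
proof -
  interpret M: module R "tensor R L2 L" by (rule module_tensor[OF modL2 modL])
  note a = tensor_assoc_linear[OF modL modL modL]
  note b = pure_tensor_bilinear[OF modL2 modL]
  show ?thesis
    using assms
    by (simp add: p3_def twist_right_pure[OF modL \<alpha>_linear B_linear] B_pure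
        bilinear_maps_simps[OF b] linear_maps_add[OF a] linear_maps_smult[OF a]
        tensor_assoc_pure[OF modL modL modL])
qed

lemmas twist_simps =
  alpha_B_p3 B_alpha_p3 linear_maps_add[OF alpha_B_linear] linear_maps_smult[OF alpha_B_linear]
  linear_maps_add[OF B_alpha_linear] linear_maps_smult[OF B_alpha_linear]

text \<open>With skew-symmetry, the Hom-Jacobi identity says that bracketing with an element is a twisted
  derivation. In this form it matches the single term on the left-hand side of the
  Hom-Yang-Baxter equation with the two terms on the right-hand side.\<close>

lemma jacobi_derivation:
  assumes "x \<in> carrier L" "y \<in> carrier L" "z \<in> carrier L"
  shows "br (\<alpha> x) (br y z) = br (br x y) (\<alpha> z) \<oplus>\<^bsub>L\<^esub> br (\<alpha> y) (br x z)"
proof -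
  let ?X = "br (\<alpha> x) (br y z)" and ?Y = "br (\<alpha> y) (br x z)" and ?Z = "br (br x y) (\<alpha> z)"
  have c: "?X \<in> carrier L" "?Y \<in> carrier L" "?Z \<in> carrier L"
    using assms by simp_all
  have neg: "f (\<ominus>\<^bsub>L\<^esub> w) = \<ominus>\<^bsub>L\<^esub> f w" if "f \<in> linear_maps R L L" "w \<in> carrier L" for f w
    using linear_maps_minus[OF modL modL that(1), of "\<zero>\<^bsub>L\<^esub>" w] that
      linear_maps_zero[OF modL modL that(1)] linear_maps_closed[OF that]
    by (simp add: a_minus_def)
  have "br (\<alpha> y) (br z x) = \<ominus>\<^bsub>L\<^esub> ?Y"
    using assms br_skew[of z x] by (simp add: neg[OF bilinear_maps_right[OF br_bilinear]])
  moreover have "br (\<alpha> z) (br x y) = \<ominus>\<^bsub>L\<^esub> ?Z"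
    using assms by (intro br_skew) simp_all
  ultimately have "?X \<oplus>\<^bsub>L\<^esub> \<ominus>\<^bsub>L\<^esub> ?Y \<oplus>\<^bsub>L\<^esub> \<ominus>\<^bsub>L\<^esub> ?Z = \<zero>\<^bsub>L\<^esub>"
    using hom_jacobi[OF assms] by simp
  then have "?X \<ominus>\<^bsub>L\<^esub> (?Z \<oplus>\<^bsub>L\<^esub> ?Y) = \<zero>\<^bsub>L\<^esub>"
    using c by (simp add: a_minus_def L.M.minus_add L.M.a_ac)
  then show ?thesis
    using c by (simp add: L.M.minus_eq_zero_iff)
qed

text \<open>After expansion the two sides differ only in the terms of the form \<open>w \<otimes> u \<otimes> u\<close>, and the
  derivation rule identifies these.\<close>

lemma hom_yang_baxter_pure:
  assumes "x \<in> carrier L" "y \<in> carrier L" "z \<in> carrier L"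
  shows "\<alpha>B (B\<alpha> (\<alpha>B (p3 x y z))) = B\<alpha> (\<alpha>B (B\<alpha> (p3 x y z)))"
proof -
  \<comment> \<open>The left-hand side contains \<open>\<alpha> [\<alpha> x, [y, z]]\<close>; moving \<open>\<alpha>\<close> into the brackets turns it into an
    instance of the derivation rule at \<open>\<alpha> x\<close>, \<open>\<alpha> y\<close>, \<open>\<alpha> z\<close>.\<close>
  have "br (\<alpha> (\<alpha> x)) (br (\<alpha> y) (\<alpha> z)) =
      br (br (\<alpha> x) (\<alpha> y)) (\<alpha> (\<alpha> z)) \<oplus>\<^bsub>L\<^esub> br (\<alpha> (\<alpha> y)) (br (\<alpha> x) (\<alpha> z))"
    using assms by (intro jacobi_derivation) simp_all
  then show ?thesis
    using assms
    by (simp add: twist_simps \<alpha>_br p3_add L3.smult_r_distr L3.smult_assoc1[symmetric])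
      (simp add: L3.M.a_ac R.m_ac)
qed

lemma B_commutes:
  assumes t: "t \<in> carrier L2"
  shows "(tensor_map R L L L L \<alpha> \<alpha> \<circ> B) t = (B \<circ> tensor_map R L L L L \<alpha> \<alpha>) t"
proof -
  note m = tensor_map_linear[OF modL modL modL modL \<alpha>_linear \<alpha>_linear]
  note m_pure = tensor_map_pure[OF modL modL modL modL \<alpha>_linear \<alpha>_linear]
  show ?thesis
    by (rule linear_maps_tensor_eqI[OF modL modL modL2 linear_maps_comp[OF B_linear m]
        linear_maps_comp[OF m B_linear] _ t])
      (simp add: B_pure m_pure linear_maps_add[OF m] linear_maps_smult[OF m] \<alpha>_br)
qed

theorem hom_yang_baxter: "hom_yang_baxter_solution R L \<alpha> B"
  unfolding hom_yang_baxter_solution_def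
proof (intro conjI ballI)
  fix t assume t: "t \<in> carrier L3"
  note lr = linear_maps_comp[OF alpha_B_linear linear_maps_comp[OF B_alpha_linear alpha_B_linear]]
    linear_maps_comp[OF B_alpha_linear linear_maps_comp[OF alpha_B_linear B_alpha_linear]]
  show "(\<alpha>B \<circ> B\<alpha> \<circ> \<alpha>B) t = (B\<alpha> \<circ> \<alpha>B \<circ> B\<alpha>) t"
    by (rule linear_maps_triple_eqI[OF modL modL modL modL3 lr _ t])
      (simp add: hom_yang_baxter_pure[unfolded p3_def])
qed (rule \<alpha>_linear B_linear B_commutes; assumption)+

end

theorem theorem4p1:
  fixes R :: "('a, 'r) ring_scheme" and L :: "('a, 'b, 'm) module_scheme"
    and br :: "'b \<Rightarrow> 'b \<Rightarrow> 'b" and \<alpha> :: "'b \<Rightarrow> 'b"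
    and u :: 'b and l \<nu> :: 'a
  assumes "hom_lie_algebra R L br \<alpha>"
    and "u \<in> hom_lie_center L br" and "\<alpha> u = u"
    and "l \<in> carrier R" and "\<nu> \<in> carrier R"
  defines "formula \<equiv> (\<lambda>B. \<forall>x\<in>carrier L. \<forall>y\<in>carrier L.
      B (pure_tensor R L L x y) =
        l \<odot>\<^bsub>tensor R L L\<^esub> pure_tensor R L L (br x y) u
          \<ominus>\<^bsub>tensor R L L\<^esub> \<nu> \<odot>\<^bsub>tensor R L L\<^esub> pure_tensor R L L (\<alpha> y) (\<alpha> x))"
  shows "(\<exists>!B. B \<in> linear_maps R (tensor R L L) (tensor R L L)
                \<inter> extensional (carrier (tensor R L L)) \<and> formula B) \<and>
         (\<forall>B \<in> linear_maps R (tensor R L L) (tensor R L L).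
            formula B \<longrightarrow> hom_yang_baxter_solution R L \<alpha> B)"
proof -
  interpret hom_lie_algebra R L br \<alpha> by fact
  let ?T = "tensor R L L" and ?p = "pure_tensor R L L"
  note modL = L.module_axioms
  note modT = module_tensor[OF modL modL]
  interpret T: module R ?T by (rule modT)
  note p = pure_tensor_bilinear[OF modL modL]
  have u: "u \<in> carrier L"
    using assms(2) by (simp add: hom_lie_center_def)
  have n: "\<ominus>\<^bsub>R\<^esub> \<nu> \<in> carrier R"
    using assms(5) by simp
  define h where "h x y = l \<odot>\<^bsub>?T\<^esub> ?p (br x y) u \<oplus>\<^bsub>?T\<^esub> (\<ominus>\<^bsub>R\<^esub> \<nu>) \<odot>\<^bsub>?T\<^esub> ?p (\<alpha> y) (\<alpha> x)" for x y
  have "(\<lambda>x y. ?p (br x y) u) \<in> bilinear_maps R L L ?T"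
    using bilinear_maps_comp[OF br_bilinear linear_maps_id linear_maps_id bilinear_maps_left[OF p u]] .
  moreover have "(\<lambda>x y. ?p (\<alpha> y) (\<alpha> x)) \<in> bilinear_maps R L L ?T"
    using bilinear_maps_flip[OF bilinear_maps_comp[OF p \<alpha>_linear \<alpha>_linear linear_maps_id]] .
  ultimately have h: "h \<in> bilinear_maps R L L ?T"
    unfolding h_def
    by (intro bilinear_maps_plus[OF modL modL modT] bilinear_maps_scale[OF modL modL modT] assms(4) n)
  have h_eq: "h x y = l \<odot>\<^bsub>?T\<^esub> ?p (br x y) u \<ominus>\<^bsub>?T\<^esub> \<nu> \<odot>\<^bsub>?T\<^esub> ?p (\<alpha> y) (\<alpha> x)"
    if "x \<in> carrier L" "y \<in> carrier L" for x y
    using that assms(5)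
    by (simp add: h_def a_minus_def T.smult_l_minus bilinear_maps_closed[OF p]
        linear_maps_closed[OF \<alpha>_linear])
  have formula: "formula B \<longleftrightarrow> (\<forall>x\<in>carrier L. \<forall>y\<in>carrier L. B (?p x y) = h x y)" for B
    unfolding formula_def by (simp add: h_eq)
  have "hom_yang_baxter_solution R L \<alpha> B" if "B \<in> linear_maps R ?T ?T" "formula B" for B
  proof -
    interpret hom_lie_operator R L br \<alpha> u l "\<ominus>\<^bsub>R\<^esub> \<nu>" B
      by unfold_locales (use assms(2-4) n that in \<open>simp_all add: formula h_def\<close>)
    show ?thesis by (rule hom_yang_baxter)
  qed
  then show ?thesis
    using tensor_lift_ex1[OF modL modL modT h] unfolding formula by blast
qed

end
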